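(* Let $\mathcal{M}_1,\mathcal{M}_2$ be structures in languages $\mathcal{L}_1,\mathcal{L}_2$, respectively, with the same domain $M$. Assume that for all (same-length, finite) tuples $\bar a,\bar b$ from $M$, $\mathrm{qftp}_{\mathcal{M}_1}(\bar a)=\mathrm{qftp}_{\mathcal{M}_1}(\bar b)$ if, and only if, $\mathrm{qftp}_{\mathcal{M}_2}(\bar a)=\mathrm{qftp}_{\mathcal{M}_2}(\bar b)$. Then $\mathcal{M}_1$ has the modelling property if, and only if, $\mathcal{M}_2$ has the modelling property.
   Context: All types are over $\emptyset$; $\mathrm{qftp}_{\mathcal{N}}(\bar i)$ is the complete quantifier-free type of $\bar i$ in $\mathcal{N}$; for a set $\Delta$ of formulas, $\mathrm{tp}^\Delta(\bar a)$ is the restriction of $\mathrm{tp}(\bar a)$ to formulas and negations of formulas in $\Delta$. Let $\mathcal{N}$ be a structure (the index structure), $T$ a complete theory with infinite models in a language $\mathcal{L}$, and $\mathbb{M}\models T$ a $\kappa$-saturated and $\kappa$-homogeneous model for a large cardinal $\kappa$ (in particular larger than $|\mathcal{L}|$, $|\mathcal{N}|$ and the length of the tuples considered). All sequences consist of tuples of the same length. A sequence $(\bar a_i:i\in\mathcal{N})$ of tuples from $\mathbb{M}$ is $\mathcal{N}$-indiscernible if for all $n$ and $i_1,\dots,i_n,j_1,\dots,j_n\in\mathcal{N}$, $\mathrm{qftp}_{\mathcal{N}}(i_1,\dots,i_n)=\mathrm{qftp}_{\mathcal{N}}(j_1,\dots,j_n)$ implies $\mathrm{tp}_{\mathbb{M}}(\bar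 a_{i_1},\dots,\bar a_{i_n})=\mathrm{tp}_{\mathbb{M}}(\bar a_{j_1},\dots,\bar a_{j_n})$. A sequence $(\bar b_i:i\in\mathcal{N})$ is (locally) based on $(\bar a_i:i\in\mathcal{N})$ if for every finite set $\Delta$ of $\mathcal{L}$-formulas, every $n$ and all $i_1,\dots,i_n\in\mathcal{N}$ there are $j_1,\dots,j_n\in\mathcal{N}$ with $\mathrm{qftp}_{\mathcal{N}}(\bar i)=\mathrm{qftp}_{\mathcal{N}}(\bar j)$ and $\mathrm{tp}^\Delta_{\mathbb{M}}(\bar b_{i_1},\dots,\bar b_{i_n})=\mathrm{tp}^\Delta_{\mathbb{M}}(\bar a_{j_1},\dots,\bar a_{j_n})$. $\mathcal{N}$ has the modelling property if for every such $T$ (in any language) and every $\mathcal{N}$-indexed sequence of tuples from $\mathbb{M}\models T$ there is an $\mathcal{N}$-indiscernible sequence in $\mathbb{M}$ based on it. *)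

theory Defs
  imports Main
begin

unbundle cardinal_syntax

text \<open>
  The symbols of a language are subsets of the types \<open>'f\<close> and \<open>'r\<close>, so that a language may have
  no function symbols or no relation symbols. Constants are function symbols of arity 0.
\<close>

record ('f, 'r) language =
  Funs :: "'f set"
  Rels :: "'r set"
  fun_arity :: "'f \<Rightarrow> nat"
  rel_arity :: "'r \<Rightarrow> nat"

text \<open>
  Variables are named by an arbitrary type \<open>'v\<close>. It is always infinite below: \<open>nat\<close> for finite
  tuples, and \<open>nat \<times> 'x\<close> for finite sequences of possibly infinite tuples indexed by elements of \<open>'x\<close>.
\<close>

datatype ('f, 'v) tm =
    Var 'v
  | App 'f "('f, 'v) tm list"

datatype ('f, 'r, 'v) fm =
    Eq "('f, 'v) tm" "('f, 'v) tm"
  | Rel 'r "('f, 'v) tm list"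
  | Neg "('f, 'r, 'v) fm"
  | Conj "('f, 'r, 'v) fm" "('f, 'r, 'v) fm"
  | Ex 'v "('f, 'r, 'v) fm"

fun wf_tm :: "('f, 'r) language \<Rightarrow> ('f, 'v) tm \<Rightarrow> bool" where
  "wf_tm L (Var x) \<longleftrightarrow> True"
| "wf_tm L (App f ts) \<longleftrightarrow> f \<in> Funs L \<and> length ts = fun_arity L f \<and> (\<forall>t\<in>set ts. wf_tm L t)"

fun wf_fm :: "('f, 'r) language \<Rightarrow> ('f, 'r, 'v) fm \<Rightarrow> bool" where
  "wf_fm L (Eq s t) \<longleftrightarrow> wf_tm L s \<and> wf_tm L t"
| "wf_fm L (Rel r ts) \<longleftrightarrow> r \<in> Rels L \<and> length ts = rel_arity L r \<and> (\<forall>t\<in>set ts. wf_tm L t)"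
| "wf_fm L (Neg \<phi>) \<longleftrightarrow> wf_fm L \<phi>"
| "wf_fm L (Conj \<phi> \<psi>) \<longleftrightarrow> wf_fm L \<phi> \<and> wf_fm L \<psi>"
| "wf_fm L (Ex x \<phi>) \<longleftrightarrow> wf_fm L \<phi>"

fun tm_vars :: "('f, 'v) tm \<Rightarrow> 'v set" where
  "tm_vars (Var x) = {x}"
| "tm_vars (App f ts) = (\<Union>t\<in>set ts. tm_vars t)"

fun free_vars :: "('f, 'r, 'v) fm \<Rightarrow> 'v set" where
  "free_vars (Eq s t) = tm_vars s \<union> tm_vars t"
| "free_vars (Rel r ts) = (\<Union>t\<in>set ts. tm_vars t)"
| "free_vars (Neg \<phi>) = free_vars \<phi>"
| "free_vars (Conj \<phi> \<psi>) = free_vars \<phi> \<union> free_vars \<psi>"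
| "free_vars (Ex x \<phi>) = free_vars \<phi> - {x}"

fun quantifier_free :: "('f, 'r, 'v) fm \<Rightarrow> bool" where
  "quantifier_free (Eq s t) \<longleftrightarrow> True"
| "quantifier_free (Rel r ts) \<longleftrightarrow> True"
| "quantifier_free (Neg \<phi>) \<longleftrightarrow> quantifier_free \<phi>"
| "quantifier_free (Conj \<phi> \<psi>) \<longleftrightarrow> quantifier_free \<phi> \<and> quantifier_free \<psi>"
| "quantifier_free (Ex x \<phi>) \<longleftrightarrow> False"

definition formulas :: "('f, 'r) language \<Rightarrow> ('f, 'r, 'v) fm set" where
  "formulas L = {\<phi>. wf_fm L \<phi>}"

definition formulas_in :: "('f, 'r) language \<Rightarrow> 'v set \<Rightarrow> ('f, 'r, 'v) fm set" where
  "formulas_in L V = {\<phi> \<in> formulas L. free_vars \<phi> \<subseteq> V}"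

definition sentences :: "('f, 'r) language \<Rightarrow> ('f, 'r, nat) fm set" where
  "sentences L = formulas_in L {}"

record ('f, 'r, 'a) struct =
  Dom :: "'a set"
  fun_interp :: "'f \<Rightarrow> 'a list \<Rightarrow> 'a"
  rel_interp :: "'r \<Rightarrow> 'a list \<Rightarrow> bool"

definition is_structure :: "('f, 'r) language \<Rightarrow> ('f, 'r, 'a) struct \<Rightarrow> bool" where
  "is_structure L M \<longleftrightarrow> Dom M \<noteq> {} \<and>
     (\<forall>f\<in>Funs L. \<forall>as. length as = fun_arity L f \<and> set as \<subseteq> Dom M \<longrightarrow> fun_interp M f as \<in> Dom M)"

fun eval_tm :: "('f, 'r, 'a) struct \<Rightarrow> ('v \<Rightarrow> 'a) \<Rightarrow> ('f, 'v) tm \<Rightarrow> 'a" where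
  "eval_tm M v (Var x) = v x"
| "eval_tm M v (App f ts) = fun_interp M f (map (eval_tm M v) ts)"

fun sat :: "('f, 'r, 'a) struct \<Rightarrow> ('v \<Rightarrow> 'a) \<Rightarrow> ('f, 'r, 'v) fm \<Rightarrow> bool" where
  "sat M v (Eq s t) \<longleftrightarrow> eval_tm M v s = eval_tm M v t"
| "sat M v (Rel r ts) \<longleftrightarrow> rel_interp M r (map (eval_tm M v) ts)"
| "sat M v (Neg \<phi>) \<longleftrightarrow> \<not> sat M v \<phi>"
| "sat M v (Conj \<phi> \<psi>) \<longleftrightarrow> sat M v \<phi> \<and> sat M v \<psi>"
| "sat M v (Ex x \<phi>) \<longleftrightarrow> (\<exists>d\<in>Dom M. sat M (v(x := d)) \<phi>)"

definition is_model ::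
    "('f, 'r) language \<Rightarrow> ('f, 'r, nat) fm set \<Rightarrow> ('f, 'r, 'a) struct \<Rightarrow> bool" where
  "is_model L T M \<longleftrightarrow>
     is_structure L M \<and> (\<forall>\<phi>\<in>T. \<forall>v. range v \<subseteq> Dom M \<longrightarrow> sat M v \<phi>)"

text \<open>
  Quantification over all models of a theory is rendered as quantification over the models whose
  domain is a subset of the type \<open>('f, 'r, nat) fm\<close>. This type is infinite and has at least as many
  elements as there are \<open>L\<close>-formulas, so by the downward Loewenheim-Skolem theorem every
  structure is elementarily equivalent to one of these, and every infinite one to an infinite one.
\<close>

definition entails :: "('f, 'r) language \<Rightarrow> ('f, 'r, nat) fm set \<Rightarrow> ('f, 'r, nat) fm \<Rightarrow> bool" where
  "entails L T \<phi> \<longleftrightarrow>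
     (\<forall>A :: ('f, 'r, ('f, 'r, nat) fm) struct. is_model L T A \<longrightarrow> is_model L {\<phi>} A)"

definition consistent :: "('f, 'r) language \<Rightarrow> ('f, 'r, nat) fm set \<Rightarrow> bool" where
  "consistent L T \<longleftrightarrow> (\<exists>A :: ('f, 'r, ('f, 'r, nat) fm) struct. is_model L T A)"

definition complete_theory :: "('f, 'r) language \<Rightarrow> ('f, 'r, nat) fm set \<Rightarrow> bool" where
  "complete_theory L T \<longleftrightarrow> T \<subseteq> sentences L \<and> consistent L T \<and>
     (\<forall>\<phi>\<in>sentences L. entails L T \<phi> \<or> entails L T (Neg \<phi>))"

definition has_infinite_models :: "('f, 'r) language \<Rightarrow> ('f, 'r, nat) fm set \<Rightarrow> bool" where
  "has_infinite_models L T \<longleftrightarrow>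
     (\<exists>A :: ('f, 'r, ('f, 'r, nat) fm) struct. is_model L T A \<and> infinite (Dom A))"

text \<open>
  The complete type over the empty set of a tuple \<open>(a x : x \<in> V)\<close>, in the variables \<open>x \<in> V\<close>.
  The values of \<open>a\<close> outside \<open>V\<close> are irrelevant.
\<close>

definition tp :: "('f, 'r) language \<Rightarrow> ('f, 'r, 'a) struct \<Rightarrow> 'v set \<Rightarrow> ('v \<Rightarrow> 'a) \<Rightarrow> ('f, 'r, 'v) fm set" where
  "tp L M V a = {\<phi> \<in> formulas_in L V. sat M a \<phi>}"

definition tp_restr ::
    "('f, 'r, 'v) fm set \<Rightarrow> ('f, 'r) language \<Rightarrow> ('f, 'r, 'a) struct \<Rightarrow> 'v set \<Rightarrow> ('v \<Rightarrow> 'a) \<Rightarrow> ('f, 'r, 'v) fm set" where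
  "tp_restr \<Delta> L M V a = tp L M V a \<inter> (\<Delta> \<union> Neg ` \<Delta>)"

definition qftp :: "('f, 'r) language \<Rightarrow> ('f, 'r, 'a) struct \<Rightarrow> 'a list \<Rightarrow> ('f, 'r, nat) fm set" where
  "qftp L M as = {\<phi> \<in> tp L M {..<length as} (\<lambda>k. as ! k). quantifier_free \<phi>}"

text \<open>The language \<open>L(A)\<close> with a new constant \<open>Inr a\<close> for each \<open>a \<in> A\<close>.\<close>

definition add_consts :: "('f, 'r) language \<Rightarrow> 'a set \<Rightarrow> ('f + 'a, 'r) language" where
  "add_consts L A = \<lparr>Funs = Inl ` Funs L \<union> Inr ` A, Rels = Rels L,
     fun_arity = case_sum (fun_arity L) (\<lambda>_. 0), rel_arity = rel_arity L\<rparr>"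

definition expand_consts :: "('f, 'r, 'a) struct \<Rightarrow> ('f + 'a, 'r, 'a) struct" where
  "expand_consts M = \<lparr>Dom = Dom M,
     fun_interp = case_sum (fun_interp M) (\<lambda>a _. a), rel_interp = rel_interp M\<rparr>"

text \<open>
  A complete \<open>n\<close>-type over \<open>A\<close>: by compactness, finite satisfiability in \<open>M\<close> is the same as
  consistency with the theory of \<open>M\<close> in \<open>L(A)\<close>.
\<close>

definition complete_type_over ::
    "('f, 'r) language \<Rightarrow> ('f, 'r, 'a) struct \<Rightarrow> 'a set \<Rightarrow> nat \<Rightarrow> ('f + 'a, 'r, nat) fm set \<Rightarrow> bool" where
  "complete_type_over L M A n p \<longleftrightarrow>
     p \<subseteq> formulas_in (add_consts L A) {..<n} \<and>
     (\<forall>\<Phi>. finite \<Phi> \<and> \<Phi> \<subseteq> p \<longrightarrow>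
        (\<exists>v. range v \<subseteq> Dom M \<and> (\<forall>\<phi>\<in>\<Phi>. sat (expand_consts M) v \<phi>))) \<and>
     (\<forall>\<phi>\<in>formulas_in (add_consts L A) {..<n}. \<phi> \<in> p \<or> Neg \<phi> \<in> p)"

definition saturated ::
    "'k rel \<Rightarrow> ('f, 'r) language \<Rightarrow> ('f, 'r, 'a) struct \<Rightarrow> bool" where
  "saturated \<kappa> L M \<longleftrightarrow>
     (\<forall>A n p. A \<subseteq> Dom M \<and> |A| <o \<kappa> \<and> complete_type_over L M A n p \<longrightarrow>
        (\<exists>v. range v \<subseteq> Dom M \<and> (\<forall>\<phi>\<in>p. sat (expand_consts M) v \<phi>)))"

definition partial_elementary ::
    "('f, 'r) language \<Rightarrow> ('f, 'r, 'a) struct \<Rightarrow> 'a set \<Rightarrow> ('a \<Rightarrow> 'a) \<Rightarrow> bool" where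
  "partial_elementary L M A f \<longleftrightarrow> A \<subseteq> Dom M \<and> f ` A \<subseteq> Dom M \<and>
     (\<forall>(\<phi> :: ('f, 'r, nat) fm) \<in> formulas L. \<forall>v. v ` free_vars \<phi> \<subseteq> A \<longrightarrow>
        (sat M v \<phi> \<longleftrightarrow> sat M (f \<circ> v) \<phi>))"

definition homogeneous ::
    "'k rel \<Rightarrow> ('f, 'r) language \<Rightarrow> ('f, 'r, 'a) struct \<Rightarrow> bool" where
  "homogeneous \<kappa> L M \<longleftrightarrow>
     (\<forall>A f a. |A| <o \<kappa> \<and> partial_elementary L M A f \<and> a \<in> Dom M \<longrightarrow>
        (\<exists>g. (\<forall>x\<in>A. g x = f x) \<and> partial_elementary L M (insert a A) g))"

text \<open>
  A sequence \<open>(a i : i \<in> Dom N)\<close> of tuples \<open>a i = (a i x : x \<in> X)\<close> is a function of type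
  \<open>'i \<Rightarrow> 'x \<Rightarrow> 'm\<close>; the common index set \<open>X\<close> of the tuples is arbitrary, possibly infinite or empty.
\<close>

definition sequence_in ::
    "('nf, 'nr, 'i) struct \<Rightarrow> ('f, 'r, 'm) struct \<Rightarrow> 'x set \<Rightarrow> ('i \<Rightarrow> 'x \<Rightarrow> 'm) \<Rightarrow> bool" where
  "sequence_in N M X a \<longleftrightarrow> (\<forall>i\<in>Dom N. \<forall>x\<in>X. a i x \<in> Dom M)"

text \<open>
  The concatenation of the tuples \<open>a i\<^sub>0, \<dots>, a i\<^sub>n\<^sub>-\<^sub>1\<close>: variable \<open>(k, x)\<close> stands for
  the \<open>x\<close>-th entry of the \<open>k\<close>-th tuple, so the variables of its type are \<open>{..<n} \<times> X\<close>.
\<close>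

definition concat_tuples :: "('i \<Rightarrow> 'x \<Rightarrow> 'm) \<Rightarrow> 'i list \<Rightarrow> nat \<times> 'x \<Rightarrow> 'm" where
  "concat_tuples a is = (\<lambda>(k, x). a (is ! k) x)"

definition indiscernible ::
    "('nf, 'nr) language \<Rightarrow> ('nf, 'nr, 'i) struct \<Rightarrow> ('f, 'r) language \<Rightarrow> ('f, 'r, 'm) struct \<Rightarrow>
     'x set \<Rightarrow> ('i \<Rightarrow> 'x \<Rightarrow> 'm) \<Rightarrow> bool" where
  "indiscernible LN N L M X a \<longleftrightarrow>
     (\<forall>n is js. length is = n \<and> length js = n \<and> set is \<subseteq> Dom N \<and> set js \<subseteq> Dom N \<and>
        qftp LN N is = qftp LN N js \<longrightarrow>
        tp L M ({..<n} \<times> X) (concat_tuples a is) = tp L M ({..<n} \<times> X) (concat_tuples a js))"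

definition based_on ::
    "('nf, 'nr) language \<Rightarrow> ('nf, 'nr, 'i) struct \<Rightarrow> ('f, 'r) language \<Rightarrow> ('f, 'r, 'm) struct \<Rightarrow>
     'x set \<Rightarrow> ('i \<Rightarrow> 'x \<Rightarrow> 'm) \<Rightarrow> ('i \<Rightarrow> 'x \<Rightarrow> 'm) \<Rightarrow> bool" where
  "based_on LN N L M X b a \<longleftrightarrow>
     (\<forall>\<Delta> n is. finite \<Delta> \<and> \<Delta> \<subseteq> formulas L \<and> length is = n \<and> set is \<subseteq> Dom N \<longrightarrow>
        (\<exists>js. length js = n \<and> set js \<subseteq> Dom N \<and> qftp LN N is = qftp LN N js \<and>
           tp_restr \<Delta> L M ({..<n} \<times> X) (concat_tuples b is) =
           tp_restr \<Delta> L M ({..<n} \<times> X) (concat_tuples a js)))"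

text \<open>
  \<open>|L|\<close> is the number of \<open>L\<close>-formulas, so \<open>\<kappa>\<close> is uncountable below. Taking \<open>\<kappa>\<close> to be a
  cardinal on the type of the elements of \<open>M\<close> is no restriction, since an infinite
  \<open>\<kappa>\<close>-saturated structure has at least \<open>\<kappa>\<close> elements.
\<close>

definition monster_model ::
    "'m rel \<Rightarrow> ('f, 'r) language \<Rightarrow> ('f, 'r, nat) fm set \<Rightarrow> ('f, 'r, 'm) struct \<Rightarrow>
     ('nf, 'nr, 'i) struct \<Rightarrow> 'x set \<Rightarrow> bool" where
  "monster_model \<kappa> L T M N X \<longleftrightarrow>
     Card_order \<kappa> \<and> |formulas L :: ('f, 'r, nat) fm set| <o \<kappa> \<and> |Dom N| <o \<kappa> \<and> |X| <o \<kappa> \<and>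
     is_model L T M \<and> saturated \<kappa> L M \<and> homogeneous \<kappa> L M"

text \<open>
  HOL cannot quantify over types inside a formula. The symbols of \<open>L\<close>, the elements of \<open>M\<close> and the
  indices of the tuples therefore range over types \<open>'f\<close>, \<open>'r\<close>, \<open>'m\<close>, \<open>'x\<close> which are parameters;
  the modelling property proper is the conjunction of the instances for all types.
\<close>

definition modelling_property ::
    "'f itself \<Rightarrow> 'r itself \<Rightarrow> 'm itself \<Rightarrow> 'x itself \<Rightarrow>
     ('nf, 'nr) language \<Rightarrow> ('nf, 'nr, 'i) struct \<Rightarrow> bool" where
  "modelling_property _ _ _ _ LN N \<longleftrightarrow>
     (\<forall>(L :: ('f, 'r) language) T (M :: ('f, 'r, 'm) struct) \<kappa> (X :: 'x set) a.
        complete_theory L T \<and> has_infinite_models L T \<and> monster_model \<kappa> L T M N X \<and>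
        sequence_in N M X a \<longrightarrow>
        (\<exists>b. sequence_in N M X b \<and> indiscernible LN N L M X b \<and> based_on LN N L M X b a))"

end

theory Submission
  imports Defs
begin

text \<open>The modelling property sees the index structure only through its domain and through the
  relation "same quantifier-free type" on tuples of equal length; the types themselves never matter.
  Two structures with the same domain and the same such relation thus have the same indiscernible
  sequences and the same notion of being based on a sequence (\<open>indiscernible_transfer\<close>,
  \<open>based_on_transfer\<close>), so a sequence \<open>b\<close> that works for one works for the
  other.\<close>

definition same_qftp_equality ::
    "('f1, 'r1) language \<Rightarrow> ('f1, 'r1, 'i) struct \<Rightarrow> ('f2, 'r2) language \<Rightarrow> ('f2, 'r2, 'i) struct \<Rightarrow> bool" where
  "same_qftp_equality L\<^sub>1 M\<^sub>1 L\<^sub>2 M\<^sub>2 \<longleftrightarrow> Dom M\<^sub>1 = Dom M\<^sub>2 \<and>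
     (\<forall>as bs. length as = length bs \<and> set as \<subseteq> Dom M\<^sub>1 \<and> set bs \<subseteq> Dom M\<^sub>1 \<longrightarrow>
        (qftp L\<^sub>1 M\<^sub>1 as = qftp L\<^sub>1 M\<^sub>1 bs \<longleftrightarrow> qftp L\<^sub>2 M\<^sub>2 as = qftp L\<^sub>2 M\<^sub>2 bs))"

lemma same_qftp_equality_sym:
  "same_qftp_equality L\<^sub>1 M\<^sub>1 L\<^sub>2 M\<^sub>2 \<Longrightarrow> same_qftp_equality L\<^sub>2 M\<^sub>2 L\<^sub>1 M\<^sub>1"
  by (simp add: same_qftp_equality_def)

text \<open>Equality of types occurs here as a premise, so it is pulled back: index tuples with the
  same type in \<open>M\<^sub>2\<close> have the same type in \<open>M\<^sub>1\<close>, where the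
  assumption applies.\<close>

lemma indiscernible_transfer:
  assumes "same_qftp_equality L\<^sub>1 M\<^sub>1 L\<^sub>2 M\<^sub>2" and "indiscernible L\<^sub>1 M\<^sub>1 L M X a"
  shows "indiscernible L\<^sub>2 M\<^sub>2 L M X a"
  using assms unfolding indiscernible_def same_qftp_equality_def by metis

text \<open>Here equality of types is part of the conclusion, so it is pushed forward from
  \<open>M\<^sub>1\<close> to \<open>M\<^sub>2\<close>.\<close>

lemma based_on_transfer:
  fixes M :: "('f, 'r, 'm) struct" and X :: "'x set"
  assumes "same_qftp_equality L\<^sub>1 M\<^sub>1 L\<^sub>2 M\<^sub>2" and "based_on L\<^sub>1 M\<^sub>1 L M X b a"
  shows "based_on L\<^sub>2 M\<^sub>2 L M X b a"
  unfolding based_on_def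
proof (intro allI impI)
  fix \<Delta> :: "('f, 'r, nat \<times> 'x) fm set" and n "is"
  assume idx: "finite \<Delta> \<and> \<Delta> \<subseteq> formulas L \<and> length is = n \<and> set is \<subseteq> Dom M\<^sub>2"
  with assms obtain js where js: "length js = n" "set js \<subseteq> Dom M\<^sub>1" "qftp L\<^sub>1 M\<^sub>1 is = qftp L\<^sub>1 M\<^sub>1 js"
      "tp_restr \<Delta> L M ({..<n} \<times> X) (concat_tuples b is) =
       tp_restr \<Delta> L M ({..<n} \<times> X) (concat_tuples a js)"
    unfolding based_on_def same_qftp_equality_def by metis
  \<comment> \<open>The same witness \<open>js\<close> serves for \<open>M\<^sub>2\<close>; the
    equation between the \<open>\<Delta>\<close>-types does not mention the index structure.\<close>
  moreover have "set js \<subseteq> Dom M\<^sub>2" "qftp L\<^sub>2 M\<^sub>2 is = qftp L\<^sub>2 M\<^sub>2 js"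
    using assms(1) idx js unfolding same_qftp_equality_def by metis+
  ultimately show "\<exists>js. length js = n \<and> set js \<subseteq> Dom M\<^sub>2 \<and> qftp L\<^sub>2 M\<^sub>2 is = qftp L\<^sub>2 M\<^sub>2 js \<and>
      tp_restr \<Delta> L M ({..<n} \<times> X) (concat_tuples b is) =
      tp_restr \<Delta> L M ({..<n} \<times> X) (concat_tuples a js)"
    by blast
qed

text \<open>One implication is enough: the relation between the two index structures is symmetric,
  so swapping them gives the converse.\<close>

lemma modelling_property_transfer:
  assumes same: "same_qftp_equality L\<^sub>1 M\<^sub>1 L\<^sub>2 M\<^sub>2"
    and mp: "modelling_property TYPE('f) TYPE('r) TYPE('m) TYPE('x) L\<^sub>1 M\<^sub>1"
  shows "modelling_property TYPE('f) TYPE('r) TYPE('m) TYPE('x) L\<^sub>2 M\<^sub>2"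
  unfolding modelling_property_def
proof (intro allI impI)
  fix L :: "('f, 'r) language" and T and M :: "('f, 'r, 'm) struct"
    and \<kappa> and X :: "'x set" and a
  assume *: "complete_theory L T \<and> has_infinite_models L T \<and> monster_model \<kappa> L T M M\<^sub>2 X \<and>
    sequence_in M\<^sub>2 M X a"
  have Dom: "Dom M\<^sub>1 = Dom M\<^sub>2"
    using same by (simp add: same_qftp_equality_def)
  \<comment> \<open>\<open>monster_model\<close> only bounds the cardinality of the index domain, so
    the same \<open>M\<close> and \<open>\<kappa>\<close> are admissible for
    \<open>M\<^sub>1\<close>.\<close>
  with * have "complete_theory L T \<and> has_infinite_models L T \<and> monster_model \<kappa> L T M M\<^sub>1 X \<and>
    sequence_in M\<^sub>1 M X a"
    by (simp add: monster_model_def sequence_in_def)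
  with mp obtain b where b: "sequence_in M\<^sub>1 M X b" "indiscernible L\<^sub>1 M\<^sub>1 L M X b"
      "based_on L\<^sub>1 M\<^sub>1 L M X b a"
    unfolding modelling_property_def by blast
  have "sequence_in M\<^sub>2 M X b"
    using b(1) Dom by (simp add: sequence_in_def)
  with indiscernible_transfer[OF same b(2)] based_on_transfer[OF same b(3)]
  show "\<exists>b. sequence_in M\<^sub>2 M X b \<and> indiscernible L\<^sub>2 M\<^sub>2 L M X b \<and> based_on L\<^sub>2 M\<^sub>2 L M X b a"
    by blast
qed

theorem lemma4p6:
  fixes L\<^sub>1 :: "('f1, 'r1) language" and M\<^sub>1 :: "('f1, 'r1, 'i) struct"
    and L\<^sub>2 :: "('f2, 'r2) language" and M\<^sub>2 :: "('f2, 'r2, 'i) struct"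
  assumes "is_structure L\<^sub>1 M\<^sub>1" and "is_structure L\<^sub>2 M\<^sub>2"
    and "Dom M\<^sub>1 = Dom M\<^sub>2"
    and "\<And>as bs. \<lbrakk>length as = length bs; set as \<subseteq> Dom M\<^sub>1; set bs \<subseteq> Dom M\<^sub>1\<rbrakk> \<Longrightarrow>
           qftp L\<^sub>1 M\<^sub>1 as = qftp L\<^sub>1 M\<^sub>1 bs \<longleftrightarrow> qftp L\<^sub>2 M\<^sub>2 as = qftp L\<^sub>2 M\<^sub>2 bs"
  shows "modelling_property TYPE('f) TYPE('r) TYPE('m) TYPE('x) L\<^sub>1 M\<^sub>1 \<longleftrightarrow>
         modelling_property TYPE('f) TYPE('r) TYPE('m) TYPE('x) L\<^sub>2 M\<^sub>2"
proof -
  have same: "same_qftp_equality L\<^sub>1 M\<^sub>1 L\<^sub>2 M\<^sub>2"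
    using assms(3,4) by (auto simp: same_qftp_equality_def)
  show ?thesis
    by (rule iffI) (erule modelling_property_transfer[OF same]
      modelling_property_transfer[OF same_qftp_equality_sym[OF same]])+
qed

end
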